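(* Let $q\in\mathbb{C}$ with $|q|<1$, let $h\in\mathbb{Z}$, $r\in\mathbb{Z}_{\ge 0}$, $s\in\mathbb{C}$, and let $x\in\mathbb{R}$ be such that the second arguments of the zeta functions below are not in $\{0,-1,-2,\dots\}$. For $a,b\in\mathbb{N}$ with $a\equiv 1\pmod 2$ and $b\equiv 1\pmod 2$, we have $$[2]_{q^b}^r\,[b]_q^s \sum_{j_1,\dots,j_r=0}^{a-1} (-1)^{j_1+\cdots+j_r}\, q^{b\sum_{l=1}^{r}(h-l+1)j_l}\, \zeta_{q^a,r}^{(h)}\!\left(s,\,bx+\frac{b(j_1+\cdots+j_r)}{a}\right)$$ $$=[2]_{q^a}^r\,[a]_q^s \sum_{j_1,\dots,j_r=0}^{b-1} (-1)^{j_1+\cdots+j_r}\, q^{a\sum_{l=1}^{r}(h-l+1)j_l}\, \zeta_{q^b,r}^{(h)}\!\left(s,\,ax+\frac{a(j_1+\cdots+j_r)}{b}\right).$$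
   Context: The $q$-number is $[y]_q=\frac{1-q^y}{1-q}$; replacing $q$ by $q^a$ gives $[y]_{q^a}=\frac{1-q^{ay}}{1-q^a}$. The multiple $q$-Euler zeta function is, for $s\in\mathbb{C}$ and $x\in\mathbb{R}$ with $x\ne 0,-1,-2,\dots$, $$\zeta_{q,r}^{(h)}(s,x)=[2]_q^r\sum_{m_1,\dots,m_r=0}^{\infty}\frac{(-1)^{m_1+\cdots+m_r}\,q^{\sum_{j=1}^r (h-j+1)m_j}}{[m_1+\cdots+m_r+x]_q^s},$$ and $\zeta_{q^a,r}^{(h)}$, $\zeta_{q^b,r}^{(h)}$ are the same expression with $q$ replaced throughout by $q^a$, $q^b$ respectively. *)

theory Defs
  imports "HOL-Analysis.Analysis"
begin

(* The base q^a is represented by the pair (q, a), because for complex q and real y the symbol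
   (q^a)^y means q^(a*y) = exp (a*y * Ln q), as in [y]_(q^a) = (1 - q^(a*y)) / (1 - q^a).
   In general this differs from the principal power (q ^ a) powr y. *)
definition q_num :: "complex \<Rightarrow> nat \<Rightarrow> real \<Rightarrow> complex" where
  "q_num q a y = (1 - q powr of_real (real a * y)) / (1 - q ^ a)"

(* The complex power [y]_(q^a)^s.  The branch of the logarithm of [y]_(q^a) is
   Ln (1 - q^(a*y)) - Ln (1 - q^a).  For y > 0, and for 0 < q < 1 with any y, this is the principal
   branch (q_num_pow_eq_powr, q_num_pow_eq_powr_real).  It can differ from it only for y < 0 and
   q not a positive real; there the principal power does not satisfy
   [a*y]_q^s = [a]_q^s * [y]_(q^a)^s. *)
definition q_num_pow :: "complex \<Rightarrow> nat \<Rightarrow> real \<Rightarrow> complex \<Rightarrow> complex" where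
  "q_num_pow q a y s = (1 - q powr of_real (real a * y)) powr s / (1 - q ^ a) powr s"

(* The multiple q-Euler zeta function for the base q^a.  The multi-index (m_1, ..., m_r) is an
   extensional function on {1..r}.  The series is summed unconditionally; infsum has the
   value 0 if the series does not converge in this sense. *)
definition q_euler_zeta :: "complex \<Rightarrow> nat \<Rightarrow> int \<Rightarrow> nat \<Rightarrow> complex \<Rightarrow> real \<Rightarrow> complex" where
  "q_euler_zeta q a h r s x =
     q_num q a 2 ^ r *
     (\<Sum>\<^sub>\<infinity>m \<in> {1..r} \<rightarrow>\<^sub>E (UNIV :: nat set).
        (-1) ^ (\<Sum>j = 1..r. m j) * (q ^ a) powi (\<Sum>j = 1..r. (h - int j + 1) * int (m j))
        / q_num_pow q a (real (\<Sum>j = 1..r. m j) + x) s)"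

lemma Re_one_minus_pos: "cmod z < 1 \<Longrightarrow> 0 < Re (1 - z)"
  using complex_Re_le_cmod[of z] by simp

lemma powr_divide_right_half_plane:
  fixes u v s :: complex
  assumes "0 < Re u" "0 < Re v"
  shows "(u / v) powr s = u powr s / v powr s"
proof -
  have nz: "u \<noteq> 0" "v \<noteq> 0" using assms by auto
  have im: "\<bar>Im (Ln u)\<bar> < pi / 2" "\<bar>Im (Ln v)\<bar> < pi / 2"
    using assms Re_Ln_pos_lt nz by blast+
  have "Ln (u / v) = Ln u - Ln v"
  proof (rule Ln_unique)
    show "exp (Ln u - Ln v) = u / v" using nz by (simp add: exp_diff)
  qed (use im in auto)
  then show ?thesis
    using nz by (simp add: powr_def exp_diff right_diff_distrib)
qed

lemma q_num_pow_eq_powr: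
  assumes "cmod q < 1" "0 < a" "0 < y"
  shows "q_num_pow q a y s = q_num q a y powr s"
proof -
  have "cmod (q powr of_real (real a * y)) = cmod q powr (real a * y)"
    using norm_powr_real_powr'[of "of_real (real a * y)" q] by simp
  also have "\<dots> < 1"
    using assms by (cases "q = 0") (auto simp: powr_def intro!: mult_pos_neg)
  finally have u: "0 < Re (1 - q powr of_real (real a * y))"
    by (rule Re_one_minus_pos)
  have "cmod (q ^ a) < 1"
    using assms by (simp add: norm_power power_less_one_iff)
  then have v: "0 < Re (1 - q ^ a)"
    by (rule Re_one_minus_pos)
  show ?thesis
    unfolding q_num_pow_def q_num_def using powr_divide_right_half_plane[OF u v] by simp
qed

lemma q_num_pow_eq_powr_real:
  fixes p :: real
  assumes "0 < p" "p < 1" "0 < a"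
  shows "q_num_pow (of_real p) a y s = q_num (of_real p) a y powr s"
proof -
  define u where "u = 1 - p powr (real a * y)"
  define v where "v = 1 - p ^ a"
  have v: "0 < v"
    using assms by (simp add: v_def power_less_one_iff)
  have eqs: "1 - complex_of_real p powr of_real (real a * y) = of_real u"
    "1 - complex_of_real p ^ a = of_real v"
    using assms powr_of_real[of p "real a * y"] by (simp_all add: u_def v_def)
  have "(complex_of_real u / of_real v) powr s = of_real u powr s / of_real v powr s"
  proof (cases "u = 0")
    case False
    have "Ln (of_real u / of_real v) = Ln (of_real u) - Ln (complex_of_real v)"
    proof (rule Ln_unique)
      show "exp (Ln (of_real u) - Ln (complex_of_real v)) = of_real u / of_real v"
        using False v by (simp add: exp_diff)
    qed (use v False mpi_less_Im_Ln[of "of_real u"] Im_Ln_le_pi[of "of_real u"]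
        in \<open>auto simp: Ln_of_real\<close>)
    then show ?thesis
      using False v by (simp add: powr_def exp_diff right_diff_distrib)
  qed simp
  then show ?thesis
    unfolding q_num_pow_def q_num_def eqs by simp
qed

end

theory Submission
  imports Defs
begin

text \<open>
  Multiplying the argument \<open>|m| + b x + b |j| / a\<close> of a \<open>q\<^sup>a\<close>-number by \<open>a\<close> gives
  \<open>|a m + b j| + a b x\<close>, where \<open>|k|\<close> is the sum of the entries of \<open>k\<close>.  Since \<open>a\<close> and \<open>b\<close> are odd, the
  sign \<open>(-1)\<^bsup>|j| + |m|\<^esup>\<close> also depends only on the combined index \<open>k = a m + b j\<close>, and the exponent
  of \<open>q\<close> is linear in \<open>k\<close>.  Hence, up to prefactors that together are symmetric in \<open>a\<close> and \<open>b\<close>,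
  each side is a sum of one function of \<open>k\<close> (\<open>euler_term\<close>, \<open>summand_eq_euler_term\<close>): over
  \<open>k = a m + b j\<close> with \<open>0 \<le> j < a\<close> on the left and over \<open>k = b n + a i\<close> with \<open>0 \<le> i < b\<close> on the
  right.  Dividing \<open>m\<close> by \<open>b\<close>, \<open>m = b u + i\<close>, turns \<open>a m + b j\<close> into \<open>b (a u + j) + a i\<close>, so the two
  families of indices coincide with multiplicity (\<open>residue_exchange_sum\<close>).

  The rearrangement needs convergence.  For \<open>q \<noteq> 0\<close> the factor \<open>(1 - q\<^bsup>N + y\<^esup>)\<^sup>s\<close> tends to \<open>1\<close>, so
  the multiple series behaves like a product of geometric series with ratios
  \<open>- q\<^bsup>a (h - l + 1)\<^esup>\<close>.  If \<open>l \<le> h\<close> for every \<open>l \<le> r\<close>, all the series converge absolutely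
  (\<open>summable_euler_term\<close>); otherwise none of them converges (\<open>not_summable_euler_term\<close>), and both
  sides are \<open>0\<close> because the sum of a divergent series is \<open>0\<close> by convention.

  For \<open>q = 0\<close> the powers \<open>0\<^sup>u\<close> and \<open>0\<^sup>v\<close> need not multiply to \<open>0\<^bsup>u + v\<^esup>\<close> when \<open>u\<close> and \<open>v\<close> have
  opposite signs, and the combined index is of no use.  All the zeta values are then one constant,
  and either it vanishes or only \<open>j = 0\<close> contributes (\<open>twisted_sum_zero_base\<close>).
\<close>

section \<open>Rearranging over the combined index\<close>

text \<open>
  The map sends \<open>(j, m)\<close> to the pair \<open>(i, n)\<close> with \<open>a m + b j = b n + a i\<close> that comes from division of
  \<open>m\<close> by \<open>b\<close> with remainder.  It moves the digit \<open>m mod b\<close> out and the digit \<open>j\<close> in, so the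
  same map with \<open>a\<close> and \<open>b\<close> exchanged undoes it.  It acts on pairs and not on the values
  \<open>k = a m + b j\<close> because \<open>k\<close> determines \<open>(j, m)\<close> only if \<open>a\<close> and \<open>b\<close> are coprime.
\<close>
lemma residue_exchange_bij:
  fixes a b :: nat
  assumes a: "0 < a" and b: "0 < b"
  shows "bij_betw (\<lambda>(j, m). (\<lambda>l\<in>A. m l mod b, \<lambda>l\<in>A. a * (m l div b) + j l))
           ((A \<rightarrow>\<^sub>E {0..<a}) \<times> (A \<rightarrow>\<^sub>E UNIV)) ((A \<rightarrow>\<^sub>E {0..<b}) \<times> (A \<rightarrow>\<^sub>E UNIV))"
  (is "bij_betw (?\<phi> a b) (?J \<times> ?M) (?I \<times> ?M)")
proof (rule bij_betw_byWitness[where f' = "?\<phi> b a"])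
  have left: "?\<phi> d c (?\<phi> c d p) = p"
    if "0 < c" and "p \<in> (A \<rightarrow>\<^sub>E {0..<c}) \<times> ?M" for c d :: nat and p
  proof (cases p)
    case (Pair j m)
    then have j: "j \<in> A \<rightarrow>\<^sub>E {0..<c}" and m: "m \<in> ?M" using that by auto
    have digit: "(c * (m l div d) + j l) mod c = j l" "(c * (m l div d) + j l) div c = m l div d"
      if "l \<in> A" for l
      using j that \<open>0 < c\<close> by (auto simp: PiE_iff)
    show ?thesis
      using j m digit by (auto simp: Pair fun_eq_iff PiE_iff extensional_def)
  qed
  show "\<forall>p\<in>?J \<times> ?M. ?\<phi> b a (?\<phi> a b p) = p" using left a by blast
  show "\<forall>p\<in>?I \<times> ?M. ?\<phi> a b (?\<phi> b a p) = p" using left b by blast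
  show "?\<phi> a b ` (?J \<times> ?M) \<subseteq> ?I \<times> ?M" using b by auto
  show "?\<phi> b a ` (?I \<times> ?M) \<subseteq> ?J \<times> ?M" using a by auto
qed

lemma residue_exchange_sum:
  fixes f :: "('i \<Rightarrow> nat) \<Rightarrow> complex" and a b :: nat
  assumes a: "0 < a" and b: "0 < b" and fin: "finite A"
    and summ: "\<And>j. j \<in> A \<rightarrow>\<^sub>E {0..<a} \<Longrightarrow>
      (\<lambda>m. f (\<lambda>l\<in>A. a * m l + b * j l)) summable_on (A \<rightarrow>\<^sub>E UNIV)"
  shows "(\<Sum>j\<in>A \<rightarrow>\<^sub>E {0..<a}. \<Sum>\<^sub>\<infinity>m\<in>A \<rightarrow>\<^sub>E UNIV. f (\<lambda>l\<in>A. a * m l + b * j l))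
       = (\<Sum>i\<in>A \<rightarrow>\<^sub>E {0..<b}. \<Sum>\<^sub>\<infinity>n\<in>A \<rightarrow>\<^sub>E UNIV. f (\<lambda>l\<in>A. b * n l + a * i l))"
proof -
  let ?M = "A \<rightarrow>\<^sub>E (UNIV :: nat set)"
  let ?J = "A \<rightarrow>\<^sub>E {0..<a}" and ?I = "A \<rightarrow>\<^sub>E {0..<b}"
  let ?F = "\<lambda>(j, m). f (\<lambda>l\<in>A. a * m l + b * j l)"
  let ?G = "\<lambda>(i, n). f (\<lambda>l\<in>A. b * n l + a * i l)"
  let ?\<phi> = "\<lambda>(j, m). (\<lambda>l\<in>A. m l mod b, \<lambda>l\<in>A. a * (m l div b) + j l)"
  have finJ: "finite ?J" and finI: "finite ?I"
    using fin by (auto intro: finite_PiE)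
  have bij: "bij_betw ?\<phi> (?J \<times> ?M) (?I \<times> ?M)"
    by (rule residue_exchange_bij[OF a b])
  have GF: "?G (?\<phi> p) = ?F p" for p
  proof (cases p)
    case (Pair j m)
    have "b * (a * (m l div b) + j l) + a * (m l mod b) = a * m l + b * j l" for l
    proof -
      have "b * (a * (m l div b) + j l) + a * (m l mod b)
          = a * (b * (m l div b) + m l mod b) + b * j l"
        unfolding distrib_left by (simp only: ac_simps)
      then show ?thesis by (simp only: mult_div_mod_eq)
    qed
    then show ?thesis
      by (simp add: Pair cong: restrict_cong)
  qed
  have F: "?F summable_on (?J \<times> ?M)"
    unfolding summable_on_iff_abs_summable_on_complex Infinite_Sum.abs_summable_on_Sigma_iff
    using summ finJ by (simp add: summable_on_iff_abs_summable_on_complex)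
  then have G: "?G summable_on (?I \<times> ?M)"
    using summable_on_reindex_bij_betw[OF bij, of ?G] by (simp only: GF)
  have "(\<Sum>j\<in>?J. \<Sum>\<^sub>\<infinity>m\<in>?M. ?F (j, m)) = infsum ?F (?J \<times> ?M)"
    using infsum_Sigma_banach[OF F] finJ by simp
  also have "\<dots> = infsum ?G (?I \<times> ?M)"
    using infsum_reindex_bij_betw[OF bij, of ?G] by (simp only: GF)
  also have "\<dots> = (\<Sum>i\<in>?I. \<Sum>\<^sub>\<infinity>n\<in>?M. ?G (i, n))"
    using infsum_Sigma_banach[OF G] finI by simp
  finally show ?thesis by simp
qed

section \<open>The common summand\<close>

definition euler_weight :: "int \<Rightarrow> nat \<Rightarrow> (nat \<Rightarrow> nat) \<Rightarrow> int" where
  "euler_weight h r k = (\<Sum>l = 1..r. (h - int l + 1) * int (k l))"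

text \<open>
  With \<open>y = a b x\<close> and \<open>k = a m + b j\<close>, this is the general term of both sides without the
  prefactors.
\<close>
definition euler_term :: "complex \<Rightarrow> int \<Rightarrow> nat \<Rightarrow> complex \<Rightarrow> real \<Rightarrow> (nat \<Rightarrow> nat) \<Rightarrow> complex" where
  "euler_term q h r s y k = (-1) ^ (\<Sum>l = 1..r. k l) * q powi euler_weight h r k
     / (1 - q powr of_real (real (\<Sum>l = 1..r. k l) + y)) powr s"

lemma euler_weight_linear:
  "euler_weight h r (\<lambda>l\<in>{1..r}. a * m l + b * j l)
     = int a * euler_weight h r m + int b * euler_weight h r j"
  unfolding euler_weight_def sum_distrib_left
  by (simp add: sum.distrib [symmetric] algebra_simps)

lemma index_sum_linear:
  "(\<Sum>l = 1..r. (\<lambda>l\<in>{1..r}. a * m l + b * j l) l)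
     = a * (\<Sum>l = 1..r. m l) + b * (\<Sum>l = 1..r. (j l :: nat))"
  unfolding sum_distrib_left by (simp add: sum.distrib [symmetric])

text \<open>
  The prefactor \<open>(1 - q\<^sup>a)\<^sup>s\<close> is the denominator of the power of the \<open>q\<^sup>a\<close>-number.  Together with
  \<open>[b]\<^sub>q\<^sup>s = (1 - q\<^sup>b)\<^sup>s / (1 - q)\<^sup>s\<close> it becomes symmetric in \<open>a\<close> and \<open>b\<close>.
\<close>
lemma summand_eq_euler_term:
  assumes q: "q \<noteq> 0" "cmod q < 1" and ab: "odd a" "odd b"
  shows "(-1) ^ (\<Sum>l = 1..r. j l) * q powi (int b * euler_weight h r j)
      * ((-1) ^ (\<Sum>l = 1..r. m l) * (q ^ a) powi euler_weight h r m
         / q_num_pow q a (real (\<Sum>l = 1..r. m l)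
             + (real b * x + real b * real (\<Sum>l = 1..r. j l) / real a)) s)
    = (1 - q ^ a) powr s
      * euler_term q h r s (real a * real b * x) (\<lambda>l\<in>{1..r}. a * m l + b * j l)"
proof -
  define M J where "M = (\<Sum>l = 1..r. m l)" and "J = (\<Sum>l = 1..r. j l)"
  have a0: "0 < a" using ab by (simp add: odd_pos)
  have arg: "real a * (real M + (real b * x + real b * real J / real a))
      = real (a * M + b * J) + real a * real b * x"
    using a0 by (simp add: field_simps)
  have sign: "(-1 :: complex) ^ J * (-1) ^ M = (-1) ^ (a * M + b * J)"
    using ab by (simp add: minus_one_power_iff)
  have pw: "q powi (int b * euler_weight h r j) * (q ^ a) powi euler_weight h r m
      = q powi (int a * euler_weight h r m + int b * euler_weight h r j)"
    using q by (simp add: power_int_add power_int_mult)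
  have "(-1) ^ J * q powi (int b * euler_weight h r j)
      * ((-1) ^ M * (q ^ a) powi euler_weight h r m
         / q_num_pow q a (real M + (real b * x + real b * real J / real a)) s)
    = ((-1) ^ J * (-1) ^ M) * (q powi (int b * euler_weight h r j) * (q ^ a) powi euler_weight h r m)
      / q_num_pow q a (real M + (real b * x + real b * real J / real a)) s"
    by simp
  also have "\<dots> = (1 - q ^ a) powr s
      * euler_term q h r s (real a * real b * x) (\<lambda>l\<in>{1..r}. a * m l + b * j l)"
    unfolding sign pw q_num_pow_def arg euler_term_def index_sum_linear euler_weight_linear
      M_def [symmetric] J_def [symmetric]
    by simp
  finally show ?thesis unfolding M_def J_def .
qed

lemma zeta_eq_euler_terms:
  assumes q: "q \<noteq> 0" "cmod q < 1" and ab: "odd a" "odd b"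
  shows "(-1) ^ (\<Sum>l = 1..r. j l) * q powi (int b * (\<Sum>l = 1..r. (h - int l + 1) * int (j l))) *
          q_euler_zeta q a h r s (real b * x + real b * real (\<Sum>l = 1..r. j l) / real a)
    = q_num q a 2 ^ r * (1 - q ^ a) powr s
      * (\<Sum>\<^sub>\<infinity>m\<in>{1..r} \<rightarrow>\<^sub>E UNIV.
           euler_term q h r s (real a * real b * x) (\<lambda>l\<in>{1..r}. a * m l + b * j l))"
proof -
  let ?y = "real b * x + real b * real (\<Sum>l = 1..r. j l) / real a"
  let ?c = "(-1) ^ (\<Sum>l = 1..r. j l) * q powi (int b * euler_weight h r j)"
  have "?c * q_euler_zeta q a h r s ?y
      = q_num q a 2 ^ r * (\<Sum>\<^sub>\<infinity>m\<in>{1..r} \<rightarrow>\<^sub>E UNIV. ?c *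
          ((-1) ^ (\<Sum>l = 1..r. m l) * (q ^ a) powi euler_weight h r m
            / q_num_pow q a (real (\<Sum>l = 1..r. m l) + ?y) s))"
    unfolding infsum_cmult_right' q_euler_zeta_def euler_weight_def by (simp only: mult_ac)
  also have "\<dots> = q_num q a 2 ^ r * (1 - q ^ a) powr s
      * (\<Sum>\<^sub>\<infinity>m\<in>{1..r} \<rightarrow>\<^sub>E UNIV.
           euler_term q h r s (real a * real b * x) (\<lambda>l\<in>{1..r}. a * m l + b * j l))"
    unfolding summand_eq_euler_term[OF q ab] infsum_cmult_right' by (simp only: mult.assoc)
  finally show ?thesis by (simp add: euler_weight_def)
qed

section \<open>Convergence\<close>

lemma tendsto_q_denominator:
  fixes q s :: complex
  assumes "cmod q < 1"
  shows "(\<lambda>N. (1 - q powr of_real (real N + y)) powr s) \<longlonglongrightarrow> 1"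
proof -
  have "(\<lambda>N. cmod (q powr of_real (real N + y))) \<longlonglongrightarrow> 0"
  proof (cases "q = 0")
    case False
    have "cmod (q powr of_real (real N + y)) = cmod q ^ N * cmod q powr y" for N
      using False norm_powr_real_powr'[of "of_real (real N + y)" q]
      by (simp add: powr_add powr_realpow)
    moreover have "(\<lambda>N. cmod q ^ N * cmod q powr y) \<longlonglongrightarrow> 0"
      using assms by (intro tendsto_mult_left_zero LIMSEQ_power_zero) auto
    ultimately show ?thesis by simp
  qed simp
  then have "(\<lambda>N. 1 - q powr of_real (real N + y)) \<longlonglongrightarrow> 1 - 0"
    by (intro tendsto_diff tendsto_const) (simp add: tendsto_norm_zero_iff)
  then have "(\<lambda>N. (1 - q powr of_real (real N + y)) powr s) \<longlonglongrightarrow> 1 powr s"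
    by (intro tendsto_powr_complex tendsto_const) auto
  then show ?thesis by simp
qed

lemma summable_prod_geometric:
  fixes p :: real
  assumes p: "0 \<le> p" "p < 1" and fin: "finite A"
  shows "(\<lambda>m. p ^ (\<Sum>l\<in>A. m l)) summable_on (A \<rightarrow>\<^sub>E (UNIV :: nat set))"
proof -
  have "(\<lambda>n. p ^ n) summable_on UNIV"
    using p by (simp add: summable_on_UNIV_nonneg_real_iff)
  then have "Infinite_Set_Sum.abs_summable_on (\<lambda>n. p ^ n) UNIV"
    using p by (simp add: abs_summable_equivalent [symmetric] norm_power)
  then have "Infinite_Set_Sum.abs_summable_on (\<lambda>m. \<Prod>l\<in>A. p ^ m l) (A \<rightarrow>\<^sub>E UNIV)"
    by (intro abs_summable_on_prod_PiE fin) auto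
  then show ?thesis
    using p by (simp add: abs_summable_equivalent [symmetric] power_sum prod_norm abs_of_nonneg prod_nonneg)
qed

text \<open>
  If all coefficients \<open>h - l + 1\<close> are at least \<open>1\<close>, the exponent of \<open>q\<close> is at least \<open>|m|\<close>, and the
  reciprocal of the denominator is bounded, being a convergent sequence in \<open>|k|\<close>.  So a constant
  multiple of \<open>|q|\<^bsup>|m|\<^esup>\<close> dominates the term.
\<close>
lemma summable_euler_term:
  assumes q: "q \<noteq> 0" "cmod q < 1" and a: "0 < a" and h: "\<forall>l\<in>{1..r}. int l \<le> h"
  shows "(\<lambda>m. euler_term q h r s y (\<lambda>l\<in>{1..r}. a * m l + b * j l))
           summable_on ({1..r} \<rightarrow>\<^sub>E UNIV)"
proof -
  have "(\<lambda>N. inverse ((1 - q powr of_real (real N + y)) powr s)) \<longlonglongrightarrow> inverse 1"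
    by (intro tendsto_inverse tendsto_q_denominator q) simp
  then have "Bseq (\<lambda>N. inverse ((1 - q powr of_real (real N + y)) powr s))"
    using convergentI convergent_imp_Bseq by blast
  then obtain B
    where "0 < B"
    and B: "\<And>N. cmod (inverse ((1 - q powr of_real (real N + y)) powr s)) \<le> B"
    by (auto elim: BseqE)
  have "cmod (euler_term q h r s y (\<lambda>l\<in>{1..r}. a * m l + b * j l))
      \<le> B * cmod q ^ (\<Sum>l = 1..r. m l)" for m
  proof -
    define k where "k = (\<lambda>l\<in>{1..r}. a * m l + b * j l)"
    have "int (\<Sum>l = 1..r. m l) \<le> euler_weight h r k"
      unfolding euler_weight_def of_nat_sum
    proof (rule sum_mono)
      fix l assume l: "l \<in> {1..r}"
      have "1 * m l \<le> a * m l" using a by (intro mult_le_mono1) simp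
      then have "m l \<le> a * m l + b * j l" by linarith
      then have "m l \<le> k l" using l by (simp add: k_def)
      then have "1 * int (m l) \<le> (h - int l + 1) * int (k l)"
        using h l by (intro mult_mono) auto
      then show "int (m l) \<le> (h - int l + 1) * int (k l)" by simp
    qed
    then have "cmod q powi euler_weight h r k \<le> cmod q powi int (\<Sum>l = 1..r. m l)"
      using q by (intro power_int_decreasing) auto
    then have W: "cmod (q powi euler_weight h r k) \<le> cmod q ^ (\<Sum>l = 1..r. m l)"
      unfolding power_int_of_nat norm_power_int .
    have "cmod (euler_term q h r s y k)
        = cmod (inverse ((1 - q powr of_real (real (\<Sum>l = 1..r. k l) + y)) powr s))
          * cmod (q powi euler_weight h r k)"
      by (simp add: euler_term_def norm_mult norm_divide norm_power norm_inverse field_simps)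
    also have "\<dots> \<le> B * cmod q ^ (\<Sum>l = 1..r. m l)"
      using \<open>0 < B\<close> by (intro mult_mono B W) auto
    finally show ?thesis by (simp add: k_def)
  qed
  moreover have "(\<lambda>m. B * cmod q ^ (\<Sum>l = 1..r. m l)) summable_on ({1..r} \<rightarrow>\<^sub>E UNIV)"
    using q by (intro summable_on_cmult_right summable_prod_geometric) auto
  ultimately show ?thesis
    unfolding summable_on_iff_abs_summable_on_complex
    by (intro Infinite_Sum.abs_summable_on_comparison_test')
qed

lemma inj_axis: "inj (\<lambda>n. \<lambda>i\<in>{1..r}. if i = l then n else 0 :: nat)" if "l \<in> {1..r}"
proof (rule injI)
  fix n n' :: nat
  assume "(\<lambda>i\<in>{1..r}. if i = l then n else 0) = (\<lambda>i\<in>{1..r}. if i = l then n' else 0)"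
  then have "(\<lambda>i\<in>{1..r}. if i = l then n else 0) l = (\<lambda>i\<in>{1..r}. if i = l then n' else 0) l"
    by (rule fun_cong)
  then show "n = n'" using that by simp
qed

text \<open>
  If some coefficient \<open>h - l + 1\<close> is not positive, the terms do not tend to \<open>0\<close> along the
  \<open>l\<close>-th axis: the power of \<open>q\<close> does not decay there and the denominator tends to \<open>1\<close>.
\<close>
lemma not_summable_euler_term:
  assumes q: "q \<noteq> 0" "cmod q < 1" and a: "0 < a" and l: "l \<in> {1..r}" "h < int l"
  shows "\<not> (\<lambda>m. euler_term q h r s y (\<lambda>l\<in>{1..r}. a * m l + b * j l))
           summable_on ({1..r} \<rightarrow>\<^sub>E UNIV)"
proof
  let ?k = "\<lambda>m. \<lambda>l\<in>{1..r}. a * m l + b * j l"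
  let ?e = "\<lambda>n. \<lambda>i\<in>{1..r}. if i = l then n else 0 :: nat"
  assume "(\<lambda>m. euler_term q h r s y (?k m)) summable_on ({1..r} \<rightarrow>\<^sub>E UNIV)"
  then have "(\<lambda>m. euler_term q h r s y (?k m)) summable_on (range ?e)"
    by (rule summable_on_subset_banach) auto
  then have "(\<lambda>n. euler_term q h r s y (?k (?e n))) summable_on UNIV"
    using summable_on_reindex[OF inj_axis[OF l(1)], of "\<lambda>m. euler_term q h r s y (?k m)"]
    by (simp add: o_def)
  then have lim0: "(\<lambda>n. euler_term q h r s y (?k (?e n))) \<longlonglongrightarrow> 0"
    by (intro summable_LIMSEQ_zero summable_on_imp_summable)
  define J where "J = b * (\<Sum>l = 1..r. j l)"
  define D where "D = (\<lambda>N. (1 - q powr of_real (real N + y)) powr s)"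
  have sum_e: "(\<Sum>i = 1..r. ?e n i) = n" for n
    using l by simp
  have weight_e: "euler_weight h r (?e n) = (h - int l + 1) * int n" for n
  proof -
    have "euler_weight h r (?e n) = (\<Sum>i = 1..r. if i = l then (h - int l + 1) * int n else 0)"
      unfolding euler_weight_def by (intro sum.cong) auto
    then show ?thesis using l by simp
  qed
  define \<delta> where "\<delta> = cmod (q powi (int b * euler_weight h r j))"
  have \<delta>: "0 < \<delta>" using q by (simp add: \<delta>_def)
  have lower: "\<delta> \<le> cmod (euler_term q h r s y (?k (?e n))) * cmod (D (a * n + J))"
    \<comment> \<open>Where the denominator vanishes, the term is \<open>0\<close> by convention and the bound fails; this
        happens for finitely many \<open>n\<close> at most.\<close>
    if D0: "D (a * n + J) \<noteq> 0" for n
  proof -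
    have "int a * ((h - int l + 1) * int n) \<le> 0"
      using l by (intro mult_nonneg_nonpos mult_nonpos_nonneg) auto
    then have "1 \<le> cmod q powi (int a * ((h - int l + 1) * int n))"
      using q power_int_decreasing[of "int a * ((h - int l + 1) * int n)" 0 "cmod q"] by simp
    then have "\<delta> * 1 \<le> \<delta> * cmod q powi (int a * ((h - int l + 1) * int n))"
      using \<delta> by (intro mult_left_mono) auto
    also have "\<dots> = cmod (q powi euler_weight h r (?k (?e n)))"
      unfolding euler_weight_linear weight_e \<delta>_def
      using q by (simp add: power_int_add norm_mult norm_power_int)
    also have "\<dots> = cmod (euler_term q h r s y (?k (?e n))) * cmod (D (a * n + J))"
      unfolding euler_term_def index_sum_linear sum_e J_def [symmetric]
      using D0 by (simp add: D_def norm_mult norm_divide norm_power)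
    finally show ?thesis by simp
  qed
  have sm: "filterlim (\<lambda>n. a * n + J) sequentially sequentially"
    using a by (intro filterlim_subseq) (auto simp: strict_mono_def)
  have limD: "(\<lambda>n. D (a * n + J)) \<longlonglongrightarrow> 1"
    using filterlim_compose[OF tendsto_q_denominator[OF q(2), of y s] sm] by (simp add: D_def)
  have "(\<lambda>n. cmod (euler_term q h r s y (?k (?e n))) * cmod (D (a * n + J))) \<longlonglongrightarrow> cmod 0 * cmod 1"
    by (intro tendsto_mult tendsto_norm lim0 limD)
  moreover have "\<forall>\<^sub>F n in sequentially. D (a * n + J) \<noteq> 0"
    using tendsto_imp_eventually_ne[OF limD, of 0] by simp
  then have "\<forall>\<^sub>F n in sequentially.
      \<delta> \<le> cmod (euler_term q h r s y (?k (?e n))) * cmod (D (a * n + J))"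
    by (rule eventually_mono) (rule lower)
  ultimately have "\<delta> \<le> cmod 0 * cmod (1 :: complex)"
    by (intro tendsto_lowerbound) auto
  then show False using \<delta> by simp
qed

section \<open>Symmetry for a nonzero base\<close>

text \<open>
  The convergence criterion mentions neither \<open>a\<close> nor \<open>b\<close> nor the residues, so the series on the
  two sides converge all together or not at all.
\<close>
lemma euler_term_sum_symmetric:
  assumes q: "q \<noteq> 0" "cmod q < 1" and a: "0 < a" and b: "0 < b"
  shows "(\<Sum>j\<in>{1..r} \<rightarrow>\<^sub>E {0..<a}. \<Sum>\<^sub>\<infinity>m\<in>{1..r} \<rightarrow>\<^sub>E UNIV.
            euler_term q h r s y (\<lambda>l\<in>{1..r}. a * m l + b * j l))
       = (\<Sum>i\<in>{1..r} \<rightarrow>\<^sub>E {0..<b}. \<Sum>\<^sub>\<infinity>n\<in>{1..r} \<rightarrow>\<^sub>E UNIV.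
            euler_term q h r s y (\<lambda>l\<in>{1..r}. b * n l + a * i l))"
proof (cases "\<forall>l\<in>{1..r}. int l \<le> h")
  case True
  then show ?thesis
    by (intro residue_exchange_sum a b summable_euler_term q) auto
next
  case False
  then obtain l where "l \<in> {1..r}" "h < int l" by force
  then show ?thesis
    using not_summable_euler_term[OF q] a b by (simp add: infsum_not_exists)
qed

section \<open>The base zero\<close>

text \<open>
  For \<open>q = 0\<close> every \<open>q\<^sup>a\<close>-number is \<open>1\<close>, because \<open>0 powr z = 0\<close> for all \<open>z\<close>.  The zeta function
  then depends only on \<open>h\<close> and \<open>r\<close>.
\<close>
definition zeta_at_zero :: "int \<Rightarrow> nat \<Rightarrow> complex" where
  "zeta_at_zero h r = (\<Sum>\<^sub>\<infinity>m \<in> {1..r} \<rightarrow>\<^sub>E (UNIV :: nat set).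
     (-1) ^ (\<Sum>j = 1..r. m j) * 0 powi euler_weight h r m)"

lemma q_euler_zeta_zero: "0 < a \<Longrightarrow> q_euler_zeta 0 a h r s x = zeta_at_zero h r"
  by (simp add: q_euler_zeta_def zeta_at_zero_def q_num_def q_num_pow_def euler_weight_def
      zero_power)

text \<open>
  With \<open>m\<close>, all its multiples have weight \<open>0\<close>; they give infinitely many terms of modulus \<open>1\<close>,
  and the series diverges.
\<close>
lemma zeta_at_zero_eq_0:
  assumes m: "m \<in> {1..r} \<rightarrow>\<^sub>E UNIV" "m \<noteq> (\<lambda>l\<in>{1..r}. 0)" "euler_weight h r m = 0"
  shows "zeta_at_zero h r = 0"
  unfolding zeta_at_zero_def
proof (rule infsum_not_exists)
  let ?f = "\<lambda>m. (-1) ^ (\<Sum>j = 1..r. m j) * 0 powi euler_weight h r m :: complex"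
  let ?e = "\<lambda>n. \<lambda>l\<in>{1..r}. n * m l"
  obtain l where l: "l \<in> {1..r}" "m l \<noteq> 0"
  proof -
    have "\<exists>l\<in>{1..r}. m l \<noteq> 0"
    proof (rule ccontr)
      assume "\<not> (\<exists>l\<in>{1..r}. m l \<noteq> 0)"
      then have "m = (\<lambda>l\<in>{1..r}. 0)"
        using m(1) by (intro PiE_ext[of m _ "\<lambda>_. UNIV"]) auto
      then show False using m(2) by contradiction
    qed
    then show ?thesis using that by blast
  qed
  have inj: "inj ?e"
    by (rule injI) (use l in \<open>auto dest!: fun_cong[where x = l]\<close>)
  have "euler_weight h r (?e n) = int n * euler_weight h r m" for n
    by (simp add: euler_weight_def sum_distrib_left mult_ac)
  then have nf: "cmod (?f (?e n)) = 1" for n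
    using m(3) by (simp add: norm_mult norm_power)
  show "\<not> ?f summable_on ({1..r} \<rightarrow>\<^sub>E UNIV)"
  proof
    assume "?f summable_on ({1..r} \<rightarrow>\<^sub>E UNIV)"
    then have "?f summable_on (range ?e)"
      by (rule summable_on_subset_banach) auto
    then have "(\<lambda>n. ?f (?e n)) summable_on UNIV"
      using summable_on_reindex[OF inj, of ?f] by (simp add: o_def)
    then have "(\<lambda>n. cmod (?f (?e n))) \<longlonglongrightarrow> 0"
      by (intro tendsto_norm_zero summable_LIMSEQ_zero summable_on_imp_summable)
    then show False unfolding nf by (simp add: LIMSEQ_const_iff)
  qed
qed

text \<open>
  If \<open>zeta_at_zero h r\<close> is nonzero, the index \<open>0\<close> is the only one of weight \<open>0\<close>, and every other
  \<open>j\<close> is killed by the factor \<open>0\<close> raised to a nonzero integer, which is \<open>0\<close> also for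
  negative exponents.
\<close>
lemma twisted_sum_zero_base:
  assumes a: "0 < a" and b: "0 < b"
  shows "(\<Sum>j \<in> {1..r} \<rightarrow>\<^sub>E {0..<a}.
      (-1) ^ (\<Sum>l = 1..r. j l) * 0 powi (int b * (\<Sum>l = 1..r. (h - int l + 1) * int (j l)))
        * q_euler_zeta 0 a h r s (f j)) = zeta_at_zero h r"
proof (cases "zeta_at_zero h r = 0")
  case True
  then show ?thesis using a by (simp add: q_euler_zeta_zero)
next
  case False
  let ?z = "\<lambda>l\<in>{1..r}. 0 :: nat"
  have z: "?z \<in> {1..r} \<rightarrow>\<^sub>E {0..<a}" using a by auto
  have "(\<Sum>j \<in> {1..r} \<rightarrow>\<^sub>E {0..<a}.
      (-1) ^ (\<Sum>l = 1..r. j l) * 0 powi (int b * euler_weight h r j) * zeta_at_zero h r)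
    = (\<Sum>j \<in> {1..r} \<rightarrow>\<^sub>E {0..<a}. if j = ?z then zeta_at_zero h r else 0)"
  proof (rule sum.cong [OF refl])
    fix j assume j: "j \<in> {1..r} \<rightarrow>\<^sub>E {0..<a}"
    show "(-1) ^ (\<Sum>l = 1..r. j l) * 0 powi (int b * euler_weight h r j) * zeta_at_zero h r
        = (if j = ?z then zeta_at_zero h r else 0)"
    proof (cases "j = ?z")
      case True
      then show ?thesis by (simp add: euler_weight_def)
    next
      case nz: False
      have "j \<in> {1..r} \<rightarrow>\<^sub>E UNIV" using j by auto
      then have "euler_weight h r j \<noteq> 0"
        using zeta_at_zero_eq_0 nz False by blast
      then show ?thesis using nz b by (simp add: power_int_0_left_if)
    qed
  qed
  also have "\<dots> = zeta_at_zero h r"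
    using z by (simp add: finite_PiE)
  finally show ?thesis using a by (simp add: q_euler_zeta_zero euler_weight_def)
qed

theorem theorem2p1:
  fixes q s :: complex and h :: int and r a b :: nat and x :: real
  assumes "cmod q < 1"
    and "odd a" and "odd b"
    and "\<And>j. j \<in> {1..r} \<rightarrow>\<^sub>E {0..<a} \<Longrightarrow>
           real b * x + real b * real (\<Sum>l = 1..r. j l) / real a \<notin> \<int>\<^sub>\<le>\<^sub>0"
    and "\<And>j. j \<in> {1..r} \<rightarrow>\<^sub>E {0..<b} \<Longrightarrow>
           real a * x + real a * real (\<Sum>l = 1..r. j l) / real b \<notin> \<int>\<^sub>\<le>\<^sub>0"
  shows
    "q_num q b 2 ^ r * q_num_pow q 1 (real b) s *
       (\<Sum>j \<in> {1..r} \<rightarrow>\<^sub>E {0..<a}.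
          (-1) ^ (\<Sum>l = 1..r. j l) * q powi (int b * (\<Sum>l = 1..r. (h - int l + 1) * int (j l))) *
          q_euler_zeta q a h r s (real b * x + real b * real (\<Sum>l = 1..r. j l) / real a))
     = q_num q a 2 ^ r * q_num_pow q 1 (real a) s *
       (\<Sum>j \<in> {1..r} \<rightarrow>\<^sub>E {0..<b}.
          (-1) ^ (\<Sum>l = 1..r. j l) * q powi (int a * (\<Sum>l = 1..r. (h - int l + 1) * int (j l))) *
          q_euler_zeta q b h r s (real a * x + real a * real (\<Sum>l = 1..r. j l) / real b))"
proof -
  have a: "0 < a" and b: "0 < b"
    using \<open>odd a\<close> \<open>odd b\<close> by (auto simp: odd_pos)
  show ?thesis
  proof (cases "q = 0")
    case True
    have unit: "q_num 0 n 2 = 1" "q_num_pow 0 1 (real n) s = 1" if "0 < n" for n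
      using that by (simp_all add: q_num_def q_num_pow_def zero_power)
    show ?thesis
      unfolding True twisted_sum_zero_base[OF a b] twisted_sum_zero_base[OF b a]
      by (simp only: unit a b)
  next
    case False
    note q = False \<open>cmod q < 1\<close>
    have num: "q_num_pow q 1 (real n) s = (1 - q ^ n) powr s / (1 - q) powr s" for n
      using False by (simp add: q_num_pow_def powr_nat')
    show ?thesis
      unfolding zeta_eq_euler_terms[OF q \<open>odd a\<close> \<open>odd b\<close>]
        zeta_eq_euler_terms[OF q \<open>odd b\<close> \<open>odd a\<close>] num sum_distrib_left [symmetric]
        mult.commute[of "real b" "real a"] euler_term_sum_symmetric[OF q a b]
      by (simp add: mult_ac)
  qed
qed

end
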